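(* Let $\nu_0=\sqrt{1-\sin^2 1}$ and $\nu_1=-\dfrac{\sin 2}{1+\cos 2}$. Let $\beta_1,\beta_2>0$ be real numbers with $\nu_0(\beta_1+\beta_2\nu_1)\geq e-1$. Let $p$ be an analytic function in $\mathbb{D}$ with $p(0)=1$ and $$1+\beta_1 zp'(z)+\beta_2 z^2p''(z)\prec e^z.$$ Then $p(z)\prec 1+\sin z$.
   Context: $\mathbb{D}=\{z\in\mathbb{C}:|z|<1\}$. For functions $f,g$ analytic in $\mathbb{D}$, $f\prec g$ ($f$ is subordinate to $g$) means there is an analytic $w:\mathbb{D}\to\mathbb{C}$ with $w(0)=0$ and $|w(z)|\leq|z|$ such that $f(z)=g(w(z))$ for all $z\in\mathbb{D}$. Numerically $\nu_0\approx 0.540302$, $\nu_1\approx -1.55741$. *)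

theory Defs
  imports "HOL-Complex_Analysis.Complex_Analysis"
begin

(* Only meant for f and g analytic in the open unit disc ball 0 1; the values of f, g, w
   outside the disc are irrelevant. *)
definition subordinate :: "(complex \<Rightarrow> complex) \<Rightarrow> (complex \<Rightarrow> complex) \<Rightarrow> bool" where
  "subordinate f g \<longleftrightarrow>
     (\<exists>w. w analytic_on ball 0 1 \<and> w 0 = 0 \<and>
          (\<forall>z\<in>ball 0 1. norm (w z) \<le> norm z) \<and>
          (\<forall>z\<in>ball 0 1. f z = g (w z)))"

definition nu0 :: real where
  "nu0 = sqrt (1 - (sin 1)\<^sup>2)"

definition nu1 :: real where
  "nu1 = - (sin 2 / (1 + cos 2))"

end

theory Submission
  imports Defs
begin

text \<open>
  Write \<open>F = \<beta>\<^sub>1 z p' + \<beta>\<^sub>2 z\<^sup>2 p''\<close>. Since \<open>F = exp w - 1\<close> with \<open>|w z| \<le> |z|\<close>, convexity of the real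
  exponential gives \<open>|F z| \<le> (e - 1) |z|\<close>. Integrating the first-order equation for \<open>p'\<close> along rays
  yields \<open>|p'| \<le> (e - 1) / \<beta>\<^sub>1\<close>, hence \<open>|p z - 1| \<le> (e - 1) |z| / \<beta>\<^sub>1 \<le> |z| cos 1\<close>, because
  \<open>\<nu>\<^sub>0 = cos 1\<close> and \<open>\<nu>\<^sub>1 < 0\<close>. On the disc of radius \<open>cos 1\<close> the derivative of \<open>Arcsin\<close> is bounded by
  \<open>1 / sin 1\<close>, so \<open>Arcsin (p z - 1)\<close> is a subordinating function, as \<open>cos 1 \<le> sin 1\<close>.
\<close>

text \<open>Along the segment from 0 to \<open>w\<close>, the speed of \<open>exp (t w)\<close> is
  at most that of the real function \<open>exp (t * norm w)\<close>, so the left side is at most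
  \<open>exp (norm w) - 1\<close>. On [0, 1] the convex exponential lies below its chord, which
  gives the linear bound.\<close>

lemma norm_exp_minus_one_le:
  fixes w :: complex
  assumes "norm w \<le> 1"
  shows "norm (exp w - 1) \<le> (exp 1 - 1) * norm w"
proof -
  have "norm (exp (of_real 1 * w) - exp (of_real 0 * w)) \<le> exp (1 * norm w) - exp (0 * norm w)"
  proof (rule differentiable_bound_general[of 0 1 "\<lambda>t. exp (of_real t * w)" "\<lambda>t. exp (t * norm w)"
        "\<lambda>t. w * exp (of_real t * w)" "\<lambda>t. norm w * exp (t * norm w)"])
    fix t :: real assume "0 < t"
    show "((\<lambda>t. exp (of_real t * w)) has_vector_derivative w * exp (of_real t * w)) (at t)"
      by (rule has_vector_derivative_real_field) (auto intro!: derivative_eq_intros)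
    show "((\<lambda>t. exp (t * norm w)) has_vector_derivative norm w * exp (t * norm w)) (at t)"
      unfolding has_real_derivative_iff_has_vector_derivative[symmetric]
      by (auto intro!: derivative_eq_intros)
    show "norm (w * exp (of_real t * w)) \<le> norm w * exp (t * norm w)"
      using \<open>0 < t\<close> norm_exp[of "of_real t * w"]
      by (simp add: norm_mult mult_left_mono complex_Re_le_cmod)
  qed (auto intro!: continuous_intros)
  moreover have "exp (norm w) \<le> (1 - norm w) * exp 0 + norm w * exp 1"
    using convex_onD[OF exp_convex, of "norm w" 0 1] assms by simp
  ultimately show ?thesis
    by (simp add: algebra_simps)
qed

text \<open>The integrating factor is \<open>s powr a\<close>, along the ray \<open>s \<mapsto> s z\<close>.\<close>

lemma norm_le_of_Euler_operator_bound:
  fixes h :: "complex \<Rightarrow> complex"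
  assumes h: "h holomorphic_on ball 0 1" and a: "a > 0"
    and bound: "\<And>z. z \<in> ball 0 1 \<Longrightarrow> z \<noteq> 0 \<Longrightarrow> norm (of_real a * h z + z * deriv h z) \<le> B"
    and z: "z \<in> ball 0 1" "z \<noteq> 0"
  shows "norm (h z) \<le> B / a"
proof -
  have ray: "of_real s * z \<in> ball 0 1" if "0 \<le> s" "s \<le> 1" for s :: real
    using that z le_less_trans[OF mult_left_le_one_le[of "norm z" s]] by (simp add: norm_mult)
  \<comment> \<open>The product rule turns the derivative of \<open>s powr a * h (s z)\<close> into
    \<open>s powr (a - 1)\<close> times the bounded expression at \<open>s z\<close>, and the
    majorant \<open>B / a * s powr a\<close> has derivative \<open>B * s powr (a - 1)\<close>. Both
    functions vanish at 0 because \<open>0 powr a = 0\<close>.\<close>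
  have "norm (of_real (1 powr a) * h (of_real 1 * z) - of_real (0 powr a) * h (of_real 0 * z))
      \<le> B / a * 1 powr a - B / a * 0 powr a"
  proof (rule differentiable_bound_general[of 0 1 "\<lambda>s. of_real (s powr a) * h (of_real s * z)"
        "\<lambda>s. B / a * s powr a"
        "\<lambda>s. of_real (s powr (a - 1)) * (of_real a * h (of_real s * z)
               + (of_real s * z) * deriv h (of_real s * z))"
        "\<lambda>s. B * s powr (a - 1)"])
    have powr: "continuous_on {0..1} (\<lambda>s::real. s powr a)"
      using a by (intro continuous_on_powr' continuous_intros) auto
    have "continuous_on {0..1} (\<lambda>s. h (of_real s * z))"
      by (rule continuous_on_compose2[OF holomorphic_on_imp_continuous_on[OF h]])
        (use ray in \<open>auto intro!: continuous_intros\<close>)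
    with powr show "continuous_on {0..1} (\<lambda>s. of_real (s powr a) * h (of_real s * z))"
      by (intro continuous_on_mult continuous_on_of_real)
    from powr show "continuous_on {0..1} (\<lambda>s. B / a * s powr a)"
      by (rule continuous_on_mult_left)
  next
    fix s :: real assume s: "0 < s" "s < 1"
    define k where "k = s powr (a - 1)"
    \<comment> \<open>This lets the common factor \<open>s powr (a - 1)\<close> be pulled out of
      both terms of the product rule.\<close>
    have split: "s powr a = k * s"
      using s by (simp add: k_def powr_diff)
    have "(h has_field_derivative deriv h (of_real s * z)) (at (of_real s * z))"
      using ray[of s] s h by (intro holomorphic_derivI[OF h]) auto
    then have "((\<lambda>x. h (x * z)) has_field_derivative deriv h (of_real s * z) * z) (at (of_real s))"
      by (rule DERIV_chain2) (auto intro!: derivative_eq_intros)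
    then have 1: "((\<lambda>s. h (of_real s * z)) has_vector_derivative deriv h (of_real s * z) * z) (at s)"
      by (rule has_vector_derivative_real_field)
    have pw: "((\<lambda>s. s powr a) has_real_derivative a * s powr (a - 1)) (at s)"
      using s by (auto intro!: derivative_eq_intros)
    then have 2: "((\<lambda>s. complex_of_real (s powr a)) has_vector_derivative
        of_real (a * s powr (a - 1))) (at s)"
      by (intro has_vector_derivative_of_real)
        (simp add: has_real_derivative_iff_has_vector_derivative)
    show "((\<lambda>s. of_real (s powr a) * h (of_real s * z)) has_vector_derivative
        of_real (s powr (a - 1)) * (of_real a * h (of_real s * z)
               + (of_real s * z) * deriv h (of_real s * z))) (at s)"
      by (rule has_vector_derivative_eq_rhs[OF has_vector_derivative_mult[OF 2 1]])
        (simp only: split k_def[symmetric] of_real_mult, simp add: algebra_simps)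
    show "((\<lambda>s. B / a * s powr a) has_vector_derivative B * s powr (a - 1)) (at s)"
      using DERIV_cmult[OF pw, of "B / a"] a
      by (simp add: has_real_derivative_iff_has_vector_derivative)
    show "norm (of_real (s powr (a - 1)) * (of_real a * h (of_real s * z)
               + (of_real s * z) * deriv h (of_real s * z))) \<le> B * s powr (a - 1)"
      using bound[OF ray[of s]] s z by (simp add: norm_mult mult.commute mult_left_mono)
  qed simp
  then show ?thesis
    using a by simp
qed

text \<open>The ray argument above bounds the derivative only away from 0. Continuity carries the
  bound to the origin, and the mean value inequality on the convex disc finishes.\<close>

lemma norm_diff_le_of_deriv_bound_on_punctured_disc:
  fixes p :: "complex \<Rightarrow> complex"
  assumes p: "p holomorphic_on ball 0 1"
    and bound: "\<And>z. z \<in> ball 0 1 \<Longrightarrow> z \<noteq> 0 \<Longrightarrow> norm (deriv p z) \<le> B"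
    and z: "z \<in> ball 0 1"
  shows "norm (p z - p 0) \<le> B * norm z"
proof (cases "z = 0")
  case False
  have "continuous_on (ball 0 1) (deriv p)"
    by (intro holomorphic_on_imp_continuous_on holomorphic_deriv p open_ball)
  then have "isCont (deriv p) 0"
    by (simp add: continuous_on_eq_continuous_at)
  then have "(deriv p \<longlongrightarrow> deriv p 0) (at 0)"
    by (simp add: isCont_def)
  moreover have "eventually (\<lambda>x. norm (deriv p x) \<le> B) (at 0)"
    unfolding eventually_at using bound by (intro exI[of _ 1]) auto
  ultimately have "norm (deriv p 0) \<le> B"
    by (intro tendsto_upperbound[OF tendsto_norm]) auto
  then have "norm (deriv p x) \<le> B" if "x \<in> ball 0 1" for x
    using bound that by (cases "x = 0") auto
  then show ?thesis
    using field_differentiable_bound[of "ball 0 1" p "deriv p" B z 0] z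
      holomorphic_derivI[OF p open_ball] has_field_derivative_at_within by force
qed simp

text \<open>The derivative of \<open>Arcsin\<close> is \<open>1 / cos (Arcsin x)\<close>, and the
  square of that cosine is \<open>1 - x\<^sup>2\<close>, of modulus at least
  \<open>1 - r\<^sup>2\<close> on the closed disc of radius \<open>r\<close>. The mean value
  inequality applies since the disc is convex.\<close>

lemma norm_Arcsin_le:
  assumes r: "r < 1" and u: "norm u \<le> r"
  shows "norm (Arcsin u) \<le> norm u / sqrt (1 - r\<^sup>2)"
proof -
  have r0: "0 \<le> r"
    using norm_ge_zero u by (rule order_trans)
  have pos: "0 < 1 - r\<^sup>2"
    using r r0 by (simp add: power_less_one_iff abs_square_less_1)
  have "norm (Arcsin u - Arcsin 0) \<le> 1 / sqrt (1 - r\<^sup>2) * norm (u - 0)"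
  proof (rule field_differentiable_bound[of "cball 0 r" _ "\<lambda>x. inverse (cos (Arcsin x))"])
    fix x :: complex assume "x \<in> cball 0 r"
    then have x: "norm x \<le> r" by simp
    \<comment> \<open>This keeps \<open>x\<close> off the branch cuts of
      \<open>Arcsin\<close>.\<close>
    have "\<bar>Re x\<bar> < 1"
      using abs_Re_le_cmod[of x] x r by linarith
    then show "(Arcsin has_field_derivative inverse (cos (Arcsin x))) (at x within cball 0 r)"
      by (blast intro: has_field_derivative_at_within[OF has_field_derivative_Arcsin])
    have "1 - r\<^sup>2 \<le> 1 - (norm x)\<^sup>2"
      using x by (simp add: power_mono)
    also have "\<dots> \<le> norm (1 - x\<^sup>2)"
      using norm_triangle_ineq2[of 1 "x\<^sup>2"] by (simp add: norm_power)
    also have "1 - x\<^sup>2 = (cos (Arcsin x))\<^sup>2"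
      by (simp add: cos_squared_eq)
    finally have "sqrt (1 - r\<^sup>2) \<le> norm (cos (Arcsin x))"
      by (intro real_le_lsqrt) (auto simp: norm_power)
    then show "norm (inverse (cos (Arcsin x))) \<le> 1 / sqrt (1 - r\<^sup>2)"
      using pos by (simp add: norm_inverse norm_divide inverse_eq_divide frac_le)
  qed (use u r0 in auto)
  then show ?thesis
    by simp
qed

lemma nu0_eq: "nu0 = cos 1"
proof -
  have "0 < cos (1::real)"
    using pi_gt3 by (intro cos_gt_zero) auto
  then show ?thesis
    by (simp add: nu0_def cos_squared_eq[symmetric])
qed

lemma nu1_neg: "nu1 < 0"
proof -
  have "0 < sin (2::real)"
    using pi_gt3 by (intro sin_gt_zero) auto
  moreover have "-1 < cos (2::real)"
    using pi_gt3 cos_monotone_0_pi[of 2 pi] by simp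
  ultimately show ?thesis
    by (simp add: nu1_def)
qed

text \<open>Cosine decreases on [0, pi], and pi / 2 - 1 < 1 because pi < 4.\<close>

lemma cos_1_le_sin_1: "cos 1 \<le> sin (1::real)"
proof -
  have "cos 1 \<le> cos (pi / 2 - 1)"
    using pi_gt3 pi_less_4 by (intro cos_monotone_0_pi_le) auto
  then show ?thesis
    by (simp add: cos_diff)
qed

theorem theorem2p8:
  fixes \<beta>1 \<beta>2 :: real and p :: "complex \<Rightarrow> complex"
  assumes "\<beta>1 > 0" and "\<beta>2 > 0"
    and "nu0 * (\<beta>1 + \<beta>2 * nu1) \<ge> exp 1 - 1"
    and "p analytic_on ball 0 1" and "p 0 = 1"
    and "subordinate
           (\<lambda>z. 1 + of_real \<beta>1 * z * deriv p z + of_real \<beta>2 * z\<^sup>2 * deriv (deriv p) z)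
           (\<lambda>z. exp z)"
  shows "subordinate p (\<lambda>z. 1 + sin z)"
proof -
  have p: "p holomorphic_on ball 0 1"
    using assms(4) by (rule analytic_imp_holomorphic)
  obtain w where w: "\<And>z. z \<in> ball 0 1 \<Longrightarrow> norm (w z) \<le> norm z"
    and eq: "\<And>z. z \<in> ball 0 1 \<Longrightarrow>
      1 + of_real \<beta>1 * z * deriv p z + of_real \<beta>2 * z\<^sup>2 * deriv (deriv p) z = exp (w z)"
    using assms(6) unfolding subordinate_def by blast
  \<comment> \<open>Dividing F by \<open>\<beta>2 * z\<close> leaves \<open>a p' + z p''\<close>,
    the form needed for the ray lemma with \<open>h = p'\<close>. With
    \<open>B = (exp 1 - 1) / \<beta>2\<close>, its conclusion \<open>B / a\<close> is exactly
    \<open>C\<close>.\<close>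
  define a where "a = \<beta>1 / \<beta>2"
  define C where "C = (exp 1 - 1) / \<beta>1"
  have cos: "0 < cos (1::real)" "cos (1::real) < 1"
    using pi_gt3 cos_monotone_0_pi[of 0 1] by (auto intro: cos_gt_zero)
  have Cpos: "0 \<le> C"
    using assms(1) by (simp add: C_def)
  have "exp 1 - 1 \<le> cos 1 * (\<beta>1 + \<beta>2 * nu1)"
    using assms(3) by (simp add: nu0_eq)
  also have "\<dots> \<le> cos 1 * \<beta>1"
    using cos assms(2) nu1_neg by (intro mult_left_mono) (auto simp: mult_le_0_iff)
  finally have C: "C \<le> cos 1"
    using assms(1) by (simp add: C_def divide_le_eq)

  have "norm (of_real a * deriv p z + z * deriv (deriv p) z) \<le> (exp 1 - 1) / \<beta>2"
    if z: "z \<in> ball 0 1" "z \<noteq> 0" for z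
  proof -
    have "exp (w z) - 1 = of_real \<beta>2 * z * (of_real a * deriv p z + z * deriv (deriv p) z)"
      using assms(2) by (simp flip: eq[OF z(1)] add: a_def field_simps power2_eq_square)
    then have "\<beta>2 * norm z * norm (of_real a * deriv p z + z * deriv (deriv p) z)
        = norm (exp (w z) - 1)"
      using assms(2) by (simp add: norm_mult)
    also have "\<dots> \<le> (exp 1 - 1) * norm (w z)"
      using w[OF z(1)] z by (intro norm_exp_minus_one_le) auto
    also have "\<dots> \<le> (exp 1 - 1) * norm z"
      using w[OF z(1)] by (intro mult_left_mono) auto
    finally have "norm z * (\<beta>2 * norm (of_real a * deriv p z + z * deriv (deriv p) z))
        \<le> norm z * (exp 1 - 1)"
      by (simp only: mult_ac)
    then have "\<beta>2 * norm (of_real a * deriv p z + z * deriv (deriv p) z) \<le> exp 1 - 1"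
      by (rule mult_left_le_imp_le) (use z in simp)
    then show ?thesis
      using assms(2) by (simp only: pos_le_divide_eq mult.commute)
  qed
  then have "norm (deriv p z) \<le> C" if "z \<in> ball 0 1" "z \<noteq> 0" for z
    using norm_le_of_Euler_operator_bound[of "deriv p" a "(exp 1 - 1) / \<beta>2" z] that p
      assms(1,2) by (simp add: holomorphic_deriv a_def C_def)
  then have p1: "norm (p z - 1) \<le> C * norm z" if "z \<in> ball 0 1" for z
    using norm_diff_le_of_deriv_bound_on_punctured_disc[OF p] that assms(5) by metis
  have p2: "norm (p z - 1) \<le> cos 1" if "z \<in> ball 0 1" for z
    using p1[OF that] that C Cpos mult_left_le[of "norm z" C] by simp

  \<comment> \<open>By \<open>p2\<close> the argument stays in a closed disc of radius less than 1,
    where \<open>Arcsin\<close> is holomorphic.\<close>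
  define v where "v z = Arcsin (p z - 1)" for z
  have "v holomorphic_on ball 0 1"
    unfolding v_def
  proof (rule holomorphic_on_compose_gen[of _ _ Arcsin "cball 0 (cos 1)", unfolded o_def])
    show "Arcsin holomorphic_on cball 0 (cos 1)"
    proof (rule holomorphic_on_Arcsin)
      fix x :: complex assume "x \<in> cball 0 (cos 1)"
      then show "\<bar>Re x\<bar> < 1"
        using abs_Re_le_cmod[of x] cos by simp
    qed
  qed (use p2 p in \<open>auto intro!: holomorphic_intros\<close>)
  then have "v analytic_on ball 0 1"
    by (simp add: analytic_on_open)
  moreover have "norm (v z) \<le> norm z" if "z \<in> ball 0 1" for z
  proof -
    have sin_pos: "0 < sin (1::real)"
      using cos cos_1_le_sin_1 by linarith
    have "norm (v z) \<le> norm (p z - 1) / sqrt (1 - (cos 1)\<^sup>2)"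
      unfolding v_def using cos p2[OF that] by (intro norm_Arcsin_le) auto
    also have "sqrt (1 - (cos 1)\<^sup>2) = sin (1::real)"
      using sin_pos by (simp add: sin_squared_eq[symmetric])
    \<comment> \<open>The loss \<open>1 / sin 1\<close> from \<open>Arcsin\<close> is absorbed
      because C \<le> cos 1 \<le> sin 1.\<close>
    also have "norm (p z - 1) / sin 1 \<le> norm z"
    proof -
      have "norm (p z - 1) \<le> C * norm z"
        using p1[OF that] .
      also have "\<dots> \<le> sin 1 * norm z"
        using C cos_1_le_sin_1 by (intro mult_right_mono) auto
      finally show ?thesis
        using sin_pos by (simp add: divide_le_eq mult.commute)
    qed
    finally show ?thesis .
  qed
  \<comment> \<open>\<open>sin\<close> undoes \<open>Arcsin\<close> at every complex number, so the
    identity needs no restriction to the disc.\<close>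
  moreover have "v 0 = 0" "\<forall>z. p z = 1 + sin (v z)"
    using assms(5) by (auto simp: v_def)
  ultimately show ?thesis
    unfolding subordinate_def by blast
qed

end
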